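(* Let $f:\mathbb{R}^{2}\rightarrow\mathbb{R}^{2}$ be an orientation-preserving homeomorphism such that $f-\mathrm{Id}$ is Lipschitz with constant $k\in[0,1]$, i.e. $\|(f(u)-u)-(f(v)-v)\|\le k\|u-v\|$ for all $u,v\in\mathbb{R}^2$. Then for every periodic orbit $\mathcal{O}=\{x,f(x),\dotsc,f^{n-1}(x)\}$ of $f$ of period $n\ge 2$, there exists a fixed point $x_{0}$ of $f$ whose linking number with $\mathcal{O}$ is non-zero, i.e. $Lk(x_0,\mathcal{O})\neq 0$.
   Context: $\|\cdot\|$ is the Euclidean norm on $\mathbb{R}^2$. A point $x$ is periodic of period $n$ if $f^n(x)=x$ and $f^k(x)\ne x$ for $1\le k\le n-1$; its orbit is $\mathcal{O}=\{x,f(x),\dotsc,f^{n-1}(x)\}$. Linking number. Let $x_0$ be a fixed point of $f$ and let $x\neq x_0$ be a periodic point of period $n$ with orbit $\mathcal{O}$. For an arc (continuous path) $c$ from $x$ to $f(x)$ in $\mathbb{R}^2\setminus\{x_0\}$, let $\gamma_c$ be the closed curve obtained by concatenating $c,f(c),\dotsc,f^{n-1}(c)$, and let $\omega(x_0,\gamma_c)\in\mathbb{Z}$ be the winding number of $\gamma_c$ around $x_0$. When $f$ preserves orientation, the class of $\omega(x_0,\gamma_c)$ modulo $n$ depends neither on the choice of $c$ nor on the choice of the point $x$ in $\mathcal{O}$. The linking number $Lk(x_0,\mathcal{O})$ is the unique integer $l\in\{0,1,\dotsc,n-1\}$ such that $\omega(x_0,\gamma_c)-l\in n\mathbb{Z}$.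 *)

theory Defs
  imports "HOL-Complex_Analysis.Complex_Analysis"
begin

text \<open>
  The Euclidean plane is the type \<^typ>\<open>complex\<close>, whose norm is the Euclidean norm of
  the plane and for which the library provides winding numbers of continuous paths.
\<close>

text \<open>
  A homeomorphism of the plane preserves orientation if its local degree is \<open>+1\<close> at every
  point \<open>p\<close>, i.e. if it maps every positively oriented circle around \<open>p\<close> to a closed curve
  winding once, positively, around \<open>f p\<close>. For a homeomorphism this winding number is \<open>1\<close> or
  \<open>-1\<close>, and it depends neither on the radius nor on \<open>p\<close>.
\<close>

definition orientation_preserving_homeo :: "(complex \<Rightarrow> complex) \<Rightarrow> bool" where
  "orientation_preserving_homeo f \<longleftrightarrow>
     (\<exists>g. homeomorphism UNIV UNIV f g) \<and>
     (\<forall>p r. r > 0 \<longrightarrow> winding_number (f \<circ> circlepath p r) (f p) = 1)"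

definition periodic_point :: "('a \<Rightarrow> 'a) \<Rightarrow> nat \<Rightarrow> 'a \<Rightarrow> bool" where
  "periodic_point f n x \<longleftrightarrow>
     n \<ge> 1 \<and> (f ^^ n) x = x \<and> (\<forall>k\<in>{1..n - 1}. (f ^^ k) x \<noteq> x)"

definition periodic_orbit :: "('a \<Rightarrow> 'a) \<Rightarrow> nat \<Rightarrow> 'a set \<Rightarrow> bool" where
  "periodic_orbit f n \<O> \<longleftrightarrow>
     (\<exists>x. periodic_point f n x \<and> \<O> = (\<lambda>i. (f ^^ i) x) ` {0..n - 1})"

text \<open>\<open>iterate_join f c m\<close> is the concatenation of the \<open>m + 1\<close> paths \<open>c, f(c), \<dots>, f\<^sup>m(c)\<close>.\<close>

primrec iterate_join :: "('a::topological_space \<Rightarrow> 'a) \<Rightarrow> (real \<Rightarrow> 'a) \<Rightarrow> nat \<Rightarrow> real \<Rightarrow> 'a" where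
  "iterate_join f c 0 = c"
| "iterate_join f c (Suc m) = iterate_join f c m +++ ((f ^^ Suc m) \<circ> c)"

text \<open>
  The period is \<open>n = card \<O>\<close>. The residue modulo \<open>n\<close> is required to be the same for all base
  points \<open>x\<close> of the orbit and all paths \<open>c\<close> from \<open>x\<close> to \<open>f x\<close> avoiding \<open>x\<^sub>0\<close>. The value is
  meaningful only if \<open>f\<close> is an orientation-preserving homeomorphism, \<open>x\<^sub>0\<close> is a fixed point
  and \<open>\<O>\<close> is a periodic orbit not containing \<open>x\<^sub>0\<close>.
\<close>

definition linking_number :: "(complex \<Rightarrow> complex) \<Rightarrow> complex \<Rightarrow> complex set \<Rightarrow> int" where
  "linking_number f x\<^sub>0 \<O> =
     (THE l. l \<in> {0..int (card \<O>) - 1} \<and>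
        (\<forall>x\<in>\<O>. \<forall>c. path c \<and> pathstart c = x \<and> pathfinish c = f x \<and> x\<^sub>0 \<notin> path_image c \<longrightarrow>
           (\<exists>m::int. winding_number (iterate_join f c (card \<O> - 1)) x\<^sub>0 - of_int l
                      = of_int (int (card \<O>) * m))))"

end

theory Submission
  imports Defs
begin

text \<open>
  Write \<open>g = f - Id\<close> for the displacement field, \<open>x\<^sub>i = f\<^sup>i x\<close> for the points of the orbit, and \<open>P\<close>
  for the closed polygon \<open>x\<^sub>0 x\<^sub>1 \<dots> x\<^sub>n = x\<^sub>0\<close>, whose edges are \<open>x\<^sub>i\<^sub>+\<^sub>1 - x\<^sub>i = g (x\<^sub>i)\<close>. The Lipschitz
  hypothesis enters in two ways, both resting on the estimate \<open>|g p - g y| \<le> t |g y|\<close> for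
  \<open>p = y + t g y\<close>, \<open>0 \<le> t \<le> 1\<close>, and on the injectivity of \<open>f\<close>.

  (a) A segment \<open>[y, f y]\<close> with \<open>f y \<noteq> y\<close> contains no fixed point. So the straight isotopy
  \<open>Id + t g\<close> from the identity to \<open>f\<close> never moves another point onto a fixed point \<open>z\<close>. Following
  the argument along this isotopy (\<open>winding_number_image_path\<close>) identifies the linking number of
  \<open>z\<close> with the orbit as the residue modulo \<open>n\<close> of the winding number of \<open>P\<close> around \<open>z\<close>
  (\<open>linking_number_eq_polygon_winding\<close>). Each edge is seen from \<open>z\<close> under an angle less than
  \<open>\<pi>\<close>, so this winding number is less than \<open>n / 2\<close> in absolute value
  (\<open>abs_Re_polygon_winding\<close>), and its residue vanishes only if it is zero itself.

  (b) On each edge, \<open>g\<close> makes an angle less than \<open>\<pi> / 2\<close> with the direction of the edge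
  (\<open>displacement_on_segment\<close>).

  It remains to find a zero of \<open>g\<close> around which \<open>P\<close> winds (\<open>zero_in_winding_region\<close>), and this
  uses only (b). By (b) the rotated field \<open>\<i> g\<close> points strictly to the left of every edge it
  starts from, and crossing a curve from right to left raises the winding number by one
  (\<open>polygon_crossing\<close>). Hence the winding number is not identically zero off \<open>P\<close>. Suppose that
  it takes positive values, and let \<open>U\<close> be a component of the complement of \<open>P\<close> on which it is
  maximal. A small step in the direction \<open>\<i> g\<close> from a point of \<open>U\<close> cannot cross \<open>P\<close>, because
  the winding number would increase; so \<open>q \<mapsto> q + \<epsilon> \<i> g q\<close> maps \<open>U\<close> into a compact part of \<open>U\<close>.
  The winding number vanishes far away, so \<open>U\<close> is bounded; as \<open>P\<close> is connected, \<open>U\<close> is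
  simply connected, hence homeomorphic to a disc by the Riemann mapping theorem, and Brouwer's
  theorem yields a fixed point of this map, i.e. a zero of \<open>g\<close> in \<open>U\<close>. If the winding number takes only non-positive values, \<open>-\<i> g\<close> and a minimum do the same.
\<close>

section \<open>The variation of the argument along a segment\<close>

lemma Re_divide_2pi_i: "Re (w / (2 * of_real pi * \<i>)) = Im w / (2 * pi)"
  by (simp add: Re_divide power2_eq_square)

lemma winding_number_eq_log_increment:
  fixes p q :: "real \<Rightarrow> complex"
  assumes q: "continuous_on {0..1} q" and pq: "\<And>t. t \<in> {0..1} \<Longrightarrow> p t = z + exp (q t)"
  shows "winding_number p z = (q 1 - q 0) / (2 * of_real pi * \<i>)"
proof -
  have "winding_number p z = winding_number (\<lambda>t. p t - z) 0"
    by (rule winding_number_offset)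
  also have "\<dots> = winding_number (exp \<circ> q) 0"
    by (intro winding_number_cong) (auto simp: pq)
  also have "\<dots> = (q 1 - q 0) / (2 * of_real pi * \<i>)"
    using winding_number_compose_exp[of q] q by (simp add: path_def pathfinish_def pathstart_def)
  finally show ?thesis .
qed

text \<open>
  The factor \<open>u\<close> rotates the segment, seen from \<open>z\<close>, away from the branch cut of \<open>Ln\<close>; it may
  be chosen once for all edges of a polygon, which makes their contributions telescope.
\<close>

lemma winding_number_linepath_Ln:
  assumes u: "\<And>y. y \<in> closed_segment a b \<Longrightarrow> u * (y - z) \<notin> \<real>\<^sub>\<le>\<^sub>0"
  shows "winding_number (linepath a b) z = (Ln (u * (b - z)) - Ln (u * (a - z))) / (2 * of_real pi * \<i>)"
proof -
  have u0: "u \<noteq> 0" using u[of a] by auto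
  define q where "q = (\<lambda>t. Ln (u * (linepath a b t - z)) - Ln u)"
  have mem: "linepath a b t \<in> closed_segment a b" if "t \<in> {0..1}" for t
    using that by (metis linepath_in_path path_image_linepath)
  have nz: "y \<noteq> z" if "y \<in> closed_segment a b" for y using u[OF that] by auto
  have "winding_number (linepath a b) z = (q 1 - q 0) / (2 * of_real pi * \<i>)"
  proof (rule winding_number_eq_log_increment)
    show "continuous_on {0..1} q" unfolding q_def
      by (intro continuous_intros) (use u mem in auto)
    show "linepath a b t = z + exp (q t)" if "t \<in> {0..1}" for t
      using nz[OF mem[OF that]] u0 by (simp add: q_def exp_diff)
  qed
  thus ?thesis by (simp add: q_def linepath_def)
qed

lemma quotient_nonpos_iff_between:
  assumes "y \<noteq> a"
  shows "(y - b) / (y - a) \<in> \<real>\<^sub>\<le>\<^sub>0 \<longleftrightarrow> y \<in> closed_segment a (b::complex)"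
proof
  assume "(y - b) / (y - a) \<in> \<real>\<^sub>\<le>\<^sub>0"
  then obtain r where r: "(y - b) / (y - a) = of_real r" "r \<le> 0"
    by (auto elim!: nonpos_Reals_cases)
  have yb: "y - b = of_real r * (y - a)" using arg_cong[OF r(1), of "\<lambda>w. w * (y - a)"] assms by simp
  define s where "s = 1 / (1 - r)"
  have s: "0 \<le> s" "s \<le> 1" "s * (1 - r) = 1" using r(2) by (auto simp: s_def)
  have "y = of_real (s * (1 - r)) * y" using s by simp
  also have "\<dots> = of_real s * b - of_real s * of_real r * a"
    using yb by (simp add: algebra_simps) (metis (no_types) add.commute diff_add_cancel distrib_left mult.assoc mult.commute right_diff_distrib)
  also have "of_real s * of_real r = (of_real (s - 1) :: complex)"
    unfolding of_real_mult[symmetric] of_real_eq_iff using s(3) by (simp add: algebra_simps)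
  finally have "y = (1 - s) *\<^sub>R a + s *\<^sub>R b" by (simp add: scaleR_conv_of_real algebra_simps)
  thus "y \<in> closed_segment a b"
    unfolding closed_segment_def using s by auto
next
  assume "y \<in> closed_segment a b"
  then obtain s where s: "0 \<le> s" "s \<le> 1" "y = (1 - s) *\<^sub>R a + s *\<^sub>R b"
    by (auto simp: closed_segment_def)
  have d: "y - a = of_real s * (b - a)" "y - b = of_real (s - 1) * (b - a)"
    using s by (auto simp: scaleR_conv_of_real algebra_simps)
  have "s \<noteq> 0" "b \<noteq> a" using d assms by auto
  hence "(y - b) / (y - a) = of_real ((s - 1) / s)" unfolding d by simp
  also have "\<dots> \<in> \<real>\<^sub>\<le>\<^sub>0"
    unfolding nonpos_Reals_of_real_iff using s \<open>s \<noteq> 0\<close> by (simp add: divide_nonpos_pos)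
  finally show "(y - b) / (y - a) \<in> \<real>\<^sub>\<le>\<^sub>0" .
qed

text \<open>
  The difference of the winding numbers around \<open>b\<close> and \<open>a\<close> is the variation of the argument
  of \<open>(y - b) / (y - a)\<close>. By \<open>quotient_nonpos_iff_between\<close> this quotient meets the branch cut of
  \<open>Ln\<close> exactly when \<open>y\<close> crosses the segment from \<open>a\<close> to \<open>b\<close>. So \<open>u = 1\<close> serves the edges that
  miss that segment and \<open>u = -1\<close> those that cross it transversally.
\<close>

lemma winding_number_linepath_quotient:
  assumes ab: "a \<notin> closed_segment p q" "b \<notin> closed_segment p q"
    and u: "\<And>y. y \<in> closed_segment p q \<Longrightarrow> u * ((y - b) / (y - a)) \<notin> \<real>\<^sub>\<le>\<^sub>0"
  shows "winding_number (linepath p q) b - winding_number (linepath p q) a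
       = (Ln (u * ((q - b) / (q - a))) - Ln (u * ((p - b) / (p - a)))) / (2 * of_real pi * \<i>)"
proof -
  have u0: "u \<noteq> 0" using u[of p] by auto
  define Q where "Q = (\<lambda>t. (linepath p q t - b) / (linepath p q t - a))"
  have mem: "linepath p q t \<in> closed_segment p q" if "t \<in> {0..1}" for t
    using that by (metis linepath_in_path path_image_linepath)
  have nz: "y \<noteq> a" "y \<noteq> b" if "y \<in> closed_segment p q" for y using ab that by auto
  obtain A where A: "path A" "pathfinish A - pathstart A = 2 * of_real pi * \<i> * winding_number (linepath p q) a"
      "\<And>t. t \<in> {0..1} \<Longrightarrow> linepath p q t = a + exp (A t)"
    using winding_number_as_continuous_log[of "linepath p q" a] ab by auto
  obtain B where B: "path B" "pathfinish B - pathstart B = 2 * of_real pi * \<i> * winding_number (linepath p q) b"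
      "\<And>t. t \<in> {0..1} \<Longrightarrow> linepath p q t = b + exp (B t)"
    using winding_number_as_continuous_log[of "linepath p q" b] ab by auto
  have "winding_number Q 0 = ((B 1 - A 1) - (B 0 - A 0)) / (2 * of_real pi * \<i>)"
  proof (rule winding_number_eq_log_increment)
    show "continuous_on {0..1} (\<lambda>t. B t - A t)"
      using A(1) B(1) unfolding path_def by (intro continuous_intros)
    show "Q t = 0 + exp (B t - A t)" if "t \<in> {0..1}" for t
    proof -
      have "linepath p q t - a = exp (A t)" "linepath p q t - b = exp (B t)"
        using A(3)[OF that] B(3)[OF that] by (simp_all add: algebra_simps)
      thus ?thesis by (simp add: Q_def exp_diff)
    qed
  qed
  moreover have "winding_number Q 0 = ((Ln (u * Q 1) - Ln u) - (Ln (u * Q 0) - Ln u)) / (2 * of_real pi * \<i>)"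
  proof (rule winding_number_eq_log_increment)
    show "continuous_on {0..1} (\<lambda>t. Ln (u * Q t) - Ln u)" unfolding Q_def
      by (intro continuous_intros) (use u mem nz in \<open>force+\<close>)
    show "Q t = 0 + exp (Ln (u * Q t) - Ln u)" if "t \<in> {0..1}" for t
      using nz[OF mem[OF that]] u0 by (simp add: Q_def exp_diff)
  qed
  ultimately have "(B 1 - B 0) - (A 1 - A 0) = Ln (u * Q 1) - Ln (u * Q 0)"
    by (simp add: field_simps)
  with A(2) B(2) show ?thesis
    by (simp add: pathfinish_def pathstart_def Q_def linepath_def field_simps)
qed

text \<open>
  An edge with direction \<open>v\<close> crosses \<open>[a, b]\<close>, where \<open>b - a\<close> points to the left of \<open>v\<close>. Along it
  the quotient \<open>(y - b) / (y - a)\<close> passes from the upper to the lower half-plane through the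
  negative axis, where the principal argument drops from \<open>\<pi>\<close> to \<open>-\<pi>\<close>; the actual variation of
  the argument therefore exceeds the difference of the principal arguments by \<open>2 \<pi>\<close>. The
  principal argument is \<open>\<pi>\<close> on the negative axis itself, so the jump occurs only when the axis is
  left, and a crossing at the end of the edge (\<open>t0 = 1\<close>) is left to the edge that follows.
\<close>

lemma linepath_crossing:
  fixes p q a b :: complex
  assumes ab: "a \<notin> closed_segment p q" "b \<notin> closed_segment p q"
    and t0: "0 \<le> t0" "t0 \<le> 1" and cross: "linepath p q t0 \<in> closed_segment a b"
    and pos: "(\<i> * (q - p)) \<bullet> (b - a) > 0"
  shows "Re (winding_number (linepath p q) b) - Re (winding_number (linepath p q) a)
       = (Im (Ln ((q - b) / (q - a))) - Im (Ln ((p - b) / (p - a)))) / (2 * pi)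
         + (if t0 < 1 then 1 else 0)"
proof -
  define Q where "Q = (\<lambda>t. (linepath p q t - b) / (linepath p q t - a))"
  have mem: "linepath p q t \<in> closed_segment p q" if "t \<in> {0..1}" for t
    using that by (metis linepath_in_path path_image_linepath)
  have nz: "linepath p q t \<noteq> a" "linepath p q t \<noteq> b" if "t \<in> {0..1}" for t
    using ab mem[OF that] by auto
  obtain s where s: "0 \<le> s" "s \<le> 1" "linepath p q t0 = (1 - s) *\<^sub>R a + s *\<^sub>R b"
    using cross by (auto simp: closed_segment_def)
  have yt: "linepath p q t = linepath p q t0 + of_real (t - t0) * (q - p)" for t
    by (simp add: linepath_def scaleR_conv_of_real algebra_simps)
  have imQ: "Im (Q t) = - (t - t0) * ((\<i> * (q - p)) \<bullet> (b - a)) / (cmod (linepath p q t - a))\<^sup>2"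
    if "t \<in> {0..1}" for t
  proof -
    have 1: "linepath p q t - a = of_real s * (b - a) + of_real (t - t0) * (q - p)"
      "linepath p q t - b = of_real s * (b - a) + of_real (t - t0) * (q - p) - (b - a)"
      by (subst yt, simp add: s scaleR_conv_of_real algebra_simps)+
    have "Q t = (linepath p q t - b) * cnj (linepath p q t - a) / (cmod (linepath p q t - a))\<^sup>2"
      unfolding Q_def by (rule complex_div_cnj)
    hence "Im (Q t) = Im ((linepath p q t - b) * cnj (linepath p q t - a)) / (cmod (linepath p q t - a))\<^sup>2"
      by (metis Im_divide_of_real of_real_power)
    also have "Im ((linepath p q t - b) * cnj (linepath p q t - a)) = - (t - t0) * ((\<i> * (q - p)) \<bullet> (b - a))"
      unfolding 1 by (simp add: inner_complex_def algebra_simps)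
    finally show ?thesis .
  qed
  have Qt0: "Q t0 \<in> \<real>\<^sub>\<le>\<^sub>0" "Q t0 \<noteq> 0" unfolding Q_def
    using nz[of t0] t0 cross quotient_nonpos_iff_between[of "linepath p q t0" a b] by auto
  have "Q t0 \<in> \<real>" using Qt0(1) nonpos_Reals_subset_Reals by blast
  hence Qt0': "Re (Q t0) < 0" "Im (Q t0) = 0"
    using Qt0 by (auto simp: complex_nonpos_Reals_iff complex_eq_iff)
  have real: "t = t0" if "t \<in> {0..1}" "Im (Q t) = 0" for t
    using imQ[OF that(1)] that nz[OF that(1)] pos by (auto split: if_splits)
  have sgn: "Im (Q t) > 0 \<longleftrightarrow> t < t0" if "t \<in> {0..1}" for t
    using nz[OF that] pos unfolding imQ[OF that]
    by (auto simp: zero_less_divide_iff mult_less_0_iff zero_less_mult_iff divide_less_0_iff)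
  have ends: "linepath p q 0 = p" "linepath p q 1 = q" by (simp_all add: linepath_def)
  have "winding_number (linepath p q) b - winding_number (linepath p q) a
       = (Ln ((-1) * ((q - b) / (q - a))) - Ln ((-1) * ((p - b) / (p - a)))) / (2 * of_real pi * \<i>)"
  proof (rule winding_number_linepath_quotient[OF ab])
    fix y assume "y \<in> closed_segment p q"
    then obtain t where t: "t \<in> {0..1}" "y = linepath p q t"
      by (metis imageE path_image_def path_image_linepath)
    show "- 1 * ((y - b) / (y - a)) \<notin> \<real>\<^sub>\<le>\<^sub>0"
    proof
      assume *: "- 1 * ((y - b) / (y - a)) \<in> \<real>\<^sub>\<le>\<^sub>0"
      moreover have "- 1 * ((y - b) / (y - a)) = - Q t" by (simp only: Q_def t mult_minus1)
      ultimately have "- Q t \<in> \<real>\<^sub>\<le>\<^sub>0" by metis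
      hence "Im (Q t) = 0" "Re (Q t) \<ge> 0" by (auto simp: complex_nonpos_Reals_iff)
      with real[of t] t Qt0' show False by auto
    qed
  qed
  also have "(-1) * ((q - b) / (q - a)) = - Q 1" by (simp only: Q_def ends mult_minus1)
  also have "(-1) * ((p - b) / (p - a)) = - Q 0" by (simp only: Q_def ends mult_minus1)
  finally have E: "winding_number (linepath p q) b - winding_number (linepath p q) a
     = (Ln (- Q 1) - Ln (- Q 0)) / (2 * of_real pi * \<i>)" .
  have Q01: "Q 0 \<noteq> 0" "Q 1 \<noteq> 0" using nz[of 0] nz[of 1] by (auto simp: Q_def)
  have "Re (winding_number (linepath p q) b - winding_number (linepath p q) a)
      = (Im (Ln (- Q 1)) - Im (Ln (- Q 0))) / (2 * pi)"
    unfolding E Re_divide_2pi_i by simp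
  moreover have "Im (Ln (- Q 0)) = Im (Ln (Q 0)) - pi"
    using sgn[of 0] t0 Qt0' Q01 by (cases "t0 = 0") (auto simp: Ln_minus)
  moreover have "Im (Ln (- Q 1)) = Im (Ln (Q 1)) + (if t0 < 1 then pi else - pi)"
    using sgn[of 1] t0 Qt0' Q01 real[of 1] by (cases "t0 = 1") (auto simp: Ln_minus)
  ultimately show ?thesis
    by (simp add: Q_def ends field_simps split: if_splits)
qed

section \<open>Winding numbers of closed polygons\<close>

definition polygon :: "(nat \<Rightarrow> complex) \<Rightarrow> nat \<Rightarrow> complex set" where
  "polygon x n = (\<Union>i<n. closed_segment (x i) (x (Suc i)))"

text \<open>
  The sum of the variations of the argument over the edges, divided by \<open>2 \<pi>\<close>: for \<open>x n = x 0\<close> this is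
  the winding number of the closed polygon.
\<close>

definition polygon_winding :: "(nat \<Rightarrow> complex) \<Rightarrow> nat \<Rightarrow> complex \<Rightarrow> complex" where
  "polygon_winding x n z = (\<Sum>i<n. winding_number (linepath (x i) (x (Suc i))) z)"

lemma compact_polygon: "compact (polygon x n)"
  by (auto simp: polygon_def)

lemma vertex_in_polygon: "x n = x 0 \<Longrightarrow> n \<ge> 1 \<Longrightarrow> i \<le> n \<Longrightarrow> x i \<in> polygon x n"
  unfolding polygon_def by (cases "i = n") (force intro: bexI[of _ 0] bexI[of _ i])+

lemma connected_polygon:
  shows "connected (polygon x n)"
proof (induction n)
  case (Suc n)
  have eq: "polygon x (Suc n) = polygon x n \<union> closed_segment (x n) (x (Suc n))"
    by (auto simp: polygon_def lessThan_Suc)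
  show ?case
  proof (cases n)
    case 0
    then show ?thesis by (simp add: polygon_def lessThan_Suc)
  next
    case (Suc m)
    hence "x n \<in> polygon x n \<inter> closed_segment (x n) (x (Suc n))" by (auto simp: polygon_def)
    thus ?thesis unfolding eq using Suc.IH by (intro connected_Un) auto
  qed
qed (simp add: polygon_def)

lemma not_in_polygonD: "z \<notin> polygon x n \<Longrightarrow> i < n \<Longrightarrow> z \<notin> closed_segment (x i) (x (Suc i))"
  by (auto simp: polygon_def)

lemma exp_polygon_winding:
  assumes "z \<notin> polygon x n"
  shows "(x 0 - z) * exp (2 * of_real pi * \<i> * polygon_winding x n z) = x n - z"
  using assms
proof (induction n)
  case (Suc n)
  have "z \<notin> polygon x n" and z: "z \<notin> closed_segment (x n) (x (Suc n))"
    using Suc.prems by (auto simp: polygon_def)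
  have "(x 0 - z) * exp (2 * of_real pi * \<i> * polygon_winding x (Suc n) z) =
     (x n - z) * exp (2 * of_real pi * \<i> * winding_number (linepath (x n) (x (Suc n))) z)"
    unfolding Suc.IH[OF \<open>z \<notin> polygon x n\<close>, symmetric]
    by (simp add: polygon_winding_def distrib_left exp_add)
  also have "\<dots> = x (Suc n) - z"
    using winding_number_exp_2pi[of "linepath (x n) (x (Suc n))" z] z by (simp add: mult.commute)
  finally show ?case .
qed (simp add: polygon_winding_def)

lemma polygon_winding_Ints:
  assumes "x n = x 0" "z \<notin> polygon x n"
  shows "polygon_winding x n z \<in> \<int>"
proof (cases n)
  case (Suc m)
  have "z \<noteq> x 0" using assms(2) unfolding polygon_def Suc by auto
  with exp_polygon_winding[OF assms(2)] assms(1)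
  have "exp (2 * of_real pi * \<i> * polygon_winding x n z) = 1" by simp
  then obtain k :: int where "2 * of_real pi * \<i> * polygon_winding x n z = of_int (2 * k) * pi * \<i>"
    unfolding exp_eq_1 by (auto simp: complex_eq_iff)
  hence "polygon_winding x n z = of_int k" by simp
  thus ?thesis by simp
qed (simp add: polygon_winding_def)

text \<open>
  Seen from a point outside it, a segment subtends an angle less than \<open>\<pi>\<close>.
\<close>

lemma abs_Re_winding_number_linepath:
  assumes "z \<notin> closed_segment a b"
  shows "\<bar>Re (winding_number (linepath a b) z)\<bar> < 1 / 2"
proof -
  have az: "a \<noteq> z" using assms by auto
  have *: "1 / (a - z) * (y - z) \<notin> \<real>\<^sub>\<le>\<^sub>0" if "y \<in> closed_segment a b" for y
  proof
    assume "1 / (a - z) * (y - z) \<in> \<real>\<^sub>\<le>\<^sub>0"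
    moreover have "1 / (a - z) * (y - z) = (z - y) / (z - a)" using az by (simp add: field_simps)
    ultimately have "z \<in> closed_segment a y" using quotient_nonpos_iff_between[of z a y] az by auto
    also have "\<dots> \<subseteq> closed_segment a b" using that by (simp add: closed_segment_subset)
    finally show False using assms by simp
  qed
  have "winding_number (linepath a b) z = Ln ((b - z) / (a - z)) / (2 * of_real pi * \<i>)"
    using winding_number_linepath_Ln[OF *] az by simp
  hence wn: "Re (winding_number (linepath a b) z) = Im (Ln ((b - z) / (a - z))) / (2 * pi)"
    by (simp only: Re_divide_2pi_i)
  moreover have "b \<noteq> z" using assms by auto
  moreover have "(b - z) / (a - z) \<notin> \<real>\<^sub>\<le>\<^sub>0" using *[of b] by simp
  ultimately have "\<bar>Im (Ln ((b - z) / (a - z)))\<bar> < pi"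
    using mpi_less_Im_Ln[of "(b - z) / (a - z)"] Im_Ln_le_pi[of "(b - z) / (a - z)"]
      Im_Ln_eq_pi[of "(b - z) / (a - z)"] az
    by (auto simp: complex_nonpos_Reals_iff less_le abs_if)
  thus ?thesis unfolding wn by (simp add: abs_mult field_simps)
qed

lemma abs_Re_polygon_winding:
  assumes "z \<notin> polygon x n" "n \<ge> 1"
  shows "\<bar>Re (polygon_winding x n z)\<bar> < n / 2"
proof -
  have "\<bar>Re (polygon_winding x n z)\<bar> \<le> (\<Sum>i<n. \<bar>Re (winding_number (linepath (x i) (x (Suc i))) z)\<bar>)"
    unfolding polygon_winding_def Re_sum by (rule sum_abs)
  also have "\<dots> < (\<Sum>i<n. 1 / 2)"
    using assms by (intro sum_strict_mono abs_Re_winding_number_linepath)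
      (auto simp: not_in_polygonD lessThan_empty_iff)
  finally show ?thesis by simp
qed

lemma polygon_winding_constant:
  assumes "x n = x 0" "connected S" "S \<inter> polygon x n = {}" "a \<in> S" "b \<in> S"
  shows "polygon_winding x n a = polygon_winding x n b"
proof -
  have S: "z \<notin> polygon x n" if "z \<in> S" for z using assms(3) that by auto
  have "continuous_on S (polygon_winding x n)"
    unfolding polygon_winding_def
    by (intro continuous_on_sum continuous_at_imp_continuous_on ballI continuous_at_winding_number)
       (auto dest!: S not_in_polygonD)
  moreover have "\<exists>e>0. \<forall>w. w \<in> S \<and> polygon_winding x n w \<noteq> polygon_winding x n z
      \<longrightarrow> e \<le> norm (polygon_winding x n w - polygon_winding x n z)" if "z \<in> S" for z
  proof (intro exI[of _ 1] conjI allI impI)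
    fix w assume w: "w \<in> S \<and> polygon_winding x n w \<noteq> polygon_winding x n z"
    have "polygon_winding x n w \<in> \<int>" "polygon_winding x n z \<in> \<int>"
      using polygon_winding_Ints[OF assms(1) S] w that by auto
    then show "1 \<le> norm (polygon_winding x n w - polygon_winding x n z)"
      using w Ints_nonzero_abs_ge1 by (auto elim!: Ints_cases simp flip: of_int_diff of_int_abs)
  qed simp
  ultimately have "polygon_winding x n constant_on S"
    by (rule continuous_discrete_range_constant[OF assms(2)])
  thus ?thesis using assms(4,5) by (auto simp: constant_on_def)
qed

text \<open>
  The rotation by \<open>- cnj z\<close> turns the whole polygon, seen from \<open>z\<close>, into the right half-plane,
  where a single branch of the logarithm serves all edges.
\<close>

lemma polygon_winding_eq_0_outside:
  assumes "x n = x 0" and far: "\<And>y. y \<in> polygon x n \<Longrightarrow> norm y < norm z"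
  shows "polygon_winding x n z = 0"
proof -
  have u: "- cnj z * (y - z) \<notin> \<real>\<^sub>\<le>\<^sub>0" if "y \<in> polygon x n" for y
  proof -
    have "Re (cnj z * y) \<le> norm z * norm y"
      by (metis complex_Re_le_cmod complex_mod_cnj norm_mult)
    also have "\<dots> < norm z * norm z" using far[OF that]
      by (intro mult_strict_left_mono) (auto intro: le_less_trans[OF norm_ge_zero])
    also have "\<dots> = Re (cnj z * z)"
      by (metis Re_complex_of_real complex_norm_square mult.commute power2_eq_square)
    finally show ?thesis by (simp add: complex_nonpos_Reals_iff algebra_simps)
  qed
  define L where "L = (\<lambda>y. Ln (- cnj z * (y - z)))"
  have "polygon_winding x n z = (\<Sum>i<n. (L (x (Suc i)) - L (x i)) / (2 * of_real pi * \<i>))"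
    unfolding polygon_winding_def L_def
    by (intro sum.cong refl winding_number_linepath_Ln u) (auto simp: polygon_def)
  also have "\<dots> = (L (x n) - L (x 0)) / (2 * of_real pi * \<i>)"
    unfolding sum_divide_distrib[symmetric] sum_lessThan_telescope[of "\<lambda>i. L (x i)"] ..
  finally show ?thesis using assms(1) by simp
qed

text \<open>
  Summed over all edges, the differences of principal arguments in \<open>linepath_crossing\<close> cancel,
  and what is left is the number of edges that meet \<open>[a, b]\<close> in a point other than their final
  one. A vertex on \<open>[a, b]\<close> is the initial point of some edge, so this number is positive.
\<close>

lemma polygon_crossing:
  assumes closed: "x n = x 0" and ab: "a \<notin> polygon x n" "b \<notin> polygon x n"
    and meets: "closed_segment a b \<inter> polygon x n \<noteq> {}"
    and pos: "\<And>i. i < n \<Longrightarrow> closed_segment a b \<inter> closed_segment (x i) (x (Suc i)) \<noteq> {} \<Longrightarrow>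
               (\<i> * (x (Suc i) - x i)) \<bullet> (b - a) > 0"
  shows "Re (polygon_winding x n b) \<ge> Re (polygon_winding x n a) + 1"
proof -
  define H where "H = (\<lambda>i. \<exists>t. 0 \<le> t \<and> t < 1 \<and> linepath (x i) (x (Suc i)) t \<in> closed_segment a b)"
  define A where "A = (\<lambda>y. Im (Ln ((y - b) / (y - a))))"
  have edge: "Re (winding_number (linepath (x i) (x (Suc i))) b) - Re (winding_number (linepath (x i) (x (Suc i))) a)
      = (A (x (Suc i)) - A (x i)) / (2 * pi) + (if H i then 1 else 0)" if i: "i < n" for i
  proof -
    note nab = not_in_polygonD[OF ab(1) i] not_in_polygonD[OF ab(2) i]
    have end1: "linepath (x i) (x (Suc i)) 1 = x (Suc i)" by (simp add: linepath_def)
    consider (half) t where "0 \<le> t" "t < 1" "linepath (x i) (x (Suc i)) t \<in> closed_segment a b"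
      | (tip) "\<not> H i" "x (Suc i) \<in> closed_segment a b"
      | (none) "\<not> H i" "x (Suc i) \<notin> closed_segment a b"
      unfolding H_def by blast
    thus ?thesis
    proof cases
      case half
      have "linepath (x i) (x (Suc i)) t \<in> closed_segment (x i) (x (Suc i))"
        using half by (metis atLeastAtMost_iff less_imp_le linepath_in_path)
      with linepath_crossing[OF nab half(1) less_imp_le[OF half(2)] half(3) pos[OF i]] half
      show ?thesis by (auto simp: A_def H_def)
    next
      case tip
      with linepath_crossing[OF nab, of 1] pos[OF i] show ?thesis
        by (auto simp: A_def end1)
    next
      case none
      have disj: "y \<notin> closed_segment a b" if "y \<in> closed_segment (x i) (x (Suc i))" for y
      proof
        assume y: "y \<in> closed_segment a b"
        obtain t where t: "t \<in> {0..1}" "y = linepath (x i) (x (Suc i)) t"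
          using \<open>y \<in> closed_segment (x i) _\<close> by (metis imageE path_image_def path_image_linepath)
        show False using y t none end1 by (cases "t = 1") (auto simp: H_def)
      qed
      have "winding_number (linepath (x i) (x (Suc i))) b - winding_number (linepath (x i) (x (Suc i))) a
       = (Ln (1 * ((x (Suc i) - b) / (x (Suc i) - a))) - Ln (1 * ((x i - b) / (x i - a)))) / (2 * of_real pi * \<i>)"
        using nab disj by (intro winding_number_linepath_quotient)
          (simp, simp, metis mult_1 quotient_nonpos_iff_between)
      hence "Re (winding_number (linepath (x i) (x (Suc i))) b - winding_number (linepath (x i) (x (Suc i))) a)
       = (A (x (Suc i)) - A (x i)) / (2 * pi)"
        by (simp only: A_def Re_divide_2pi_i mult_1 minus_complex.sel)
      thus ?thesis using none by simp
    qed
  qed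
  have "Re (polygon_winding x n b) - Re (polygon_winding x n a)
      = (\<Sum>i<n. (A (x (Suc i)) - A (x i)) / (2 * pi) + (if H i then 1 else 0))"
    unfolding polygon_winding_def Re_sum sum_subtractf[symmetric]
    by (intro sum.cong refl edge) auto
  also have "\<dots> = (A (x n) - A (x 0)) / (2 * pi) + (\<Sum>i<n. if H i then 1 else 0)"
    by (simp add: sum.distrib sum_lessThan_telescope[of "\<lambda>i. A (x i)"] flip: sum_divide_distrib)
  also have "\<dots> = (\<Sum>i<n. if H i then 1 else 0)" using closed by simp
  also have "\<dots> \<ge> 1"
  proof -
    have "\<exists>j<n. H j"
    proof -
      obtain y i where y: "y \<in> closed_segment a b" "i < n" "y \<in> closed_segment (x i) (x (Suc i))"
        using meets by (auto simp: polygon_def)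
      obtain t where t: "t \<in> {0..1}" "y = linepath (x i) (x (Suc i)) t"
        using y(3) by (metis imageE path_image_def path_image_linepath)
      show ?thesis
      proof (cases "t = 1")
        case False
        thus ?thesis using t y by (intro exI[of _ i]) (auto simp: H_def intro!: exI[of _ t])
      next
        case True
        hence yx: "y = x (Suc i)" using t by (simp add: linepath_def)
        define j where "j = (if Suc i = n then 0 else Suc i)"
        have "j < n" "x j = y" using y closed yx by (auto simp: j_def)
        moreover have "H j" unfolding H_def using y \<open>x j = y\<close>
          by (intro exI[of _ 0]) (auto simp: linepath_def)
        ultimately show ?thesis by blast
      qed
    qed
    then obtain j where j: "j < n" "H j" by blast
    have "(if H j then 1 else 0) \<le> (\<Sum>i<n. if H i then 1 else (0::real))"
      using j by (intro member_le_sum) auto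
    thus ?thesis using j by simp
  qed
  finally show ?thesis by simp
qed

section \<open>Vector fields close to the direction of a closed polygon\<close>

text \<open>
  By the Riemann mapping theorem \<open>U\<close> may be taken to be the open unit disc. The map sends any
  smaller concentric closed disc containing \<open>C\<close> into itself, so Brouwer's theorem applies, whatever the boundary
  of \<open>U\<close> looks like.
\<close>

lemma fixed_point_simply_connected:
  fixes \<phi> :: "complex \<Rightarrow> complex"
  assumes U: "open U" "simply_connected U" "U \<noteq> {}"
    and \<phi>: "continuous_on U \<phi>" and C: "compact C" "C \<subseteq> U" "\<phi> ` U \<subseteq> C"
  obtains z where "z \<in> U" "\<phi> z = z"
proof -
  have "U homeomorphic ball (0::complex) 1"
    using simply_connected_eq_homeomorphic_to_disc[OF U(1)] U by auto
  then obtain h k where hk: "homeomorphism U (ball (0::complex) 1) h k"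
    by (auto simp: homeomorphic_def)
  have "C \<noteq> {}" using U(3) C(3) by auto
  have conth: "continuous_on C h"
    using hk C(2) by (meson continuous_on_subset homeomorphism_def)
  hence "compact (h ` C)" using C(1) compact_continuous_image by blast
  then obtain m where m: "m \<in> h ` C" "\<And>w. w \<in> h ` C \<Longrightarrow> norm w \<le> norm m"
    using continuous_attains_sup[of "h ` C" norm] \<open>C \<noteq> {}\<close>
    by (metis continuous_on_norm_id image_is_empty)
  have "norm m < 1" using m(1) C(2) hk by (auto simp: homeomorphism_def)
  then obtain r where r: "norm m < r" "r < 1" using dense by blast
  have r0: "r > 0" using r norm_ge_zero[of m] by linarith
  have sub: "cball 0 r \<subseteq> ball (0::complex) 1" using r by auto
  have kU: "k w \<in> U" if "w \<in> cball 0 r" for w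
    using hk sub that by (auto simp: homeomorphism_def)
  have "continuous_on (cball 0 r) (\<lambda>w. h (\<phi> (k w)))"
  proof (rule continuous_on_compose2[OF conth])
    show "continuous_on (cball 0 r) (\<lambda>w. \<phi> (k w))"
      using hk sub kU by (intro continuous_on_compose2[OF \<phi>])
        (auto simp: homeomorphism_def intro: continuous_on_subset)
    show "(\<lambda>w. \<phi> (k w)) ` cball 0 r \<subseteq> C" using kU C(3) by blast
  qed
  moreover have "(\<lambda>w. h (\<phi> (k w))) \<in> cball 0 r \<rightarrow> cball 0 r"
  proof
    fix w :: complex assume "w \<in> cball 0 r"
    hence "\<phi> (k w) \<in> C" using kU C(3) by blast
    thus "h (\<phi> (k w)) \<in> cball 0 r" using m(2)[of "h (\<phi> (k w))"] r by auto
  qed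
  ultimately obtain w where w: "w \<in> cball 0 r" "h (\<phi> (k w)) = w"
    using brouwer_ball[OF r0, where f = "\<lambda>w. h (\<phi> (k w))"] by blast
  have "\<phi> (k w) \<in> U" using kU[OF w(1)] C by blast
  hence "\<phi> (k w) = k w" using hk w(2) by (metis homeomorphism_apply1)
  thus ?thesis using that kU[OF w(1)] by blast
qed

text \<open>
  A line that is not parallel to an edge meets it at most once.
\<close>

lemma finite_transversal_meets:
  assumes "\<And>i t. i < n \<Longrightarrow> t \<in> I \<Longrightarrow> q + of_real t * d \<in> closed_segment (x i) (x (Suc i)) \<Longrightarrow>
      (\<i> * (x (Suc i) - x i)) \<bullet> d \<noteq> 0"
  shows "finite {t \<in> I. q + of_real t * d \<in> polygon x n}"
proof -
  have "finite {t \<in> I. q + of_real t * d \<in> closed_segment (x i) (x (Suc i))}" (is "finite ?S")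
    if i: "i < n" for i
  proof -
    have "t = t'" if t: "t \<in> ?S" "t' \<in> ?S" for t t'
    proof -
      have coll: "(\<i> * (x (Suc i) - x i)) \<bullet> (y - x i) = 0" if "y \<in> closed_segment (x i) (x (Suc i))" for y
      proof -
        obtain u where "y = (1 - u) *\<^sub>R x i + u *\<^sub>R x (Suc i)" using \<open>y \<in> _\<close> by (auto simp: in_segment)
        hence "y - x i = u *\<^sub>R (x (Suc i) - x i)" by (simp add: algebra_simps)
        thus ?thesis by (simp only: inner_scaleR_right) (simp add: inner_complex_def algebra_simps)
      qed
      have "(\<i> * (x (Suc i) - x i)) \<bullet> (q + of_real t * d - x i) = 0"
        "(\<i> * (x (Suc i) - x i)) \<bullet> (q + of_real t' * d - x i) = 0"
        using t coll by auto
      hence "(t - t') * ((\<i> * (x (Suc i) - x i)) \<bullet> d) = 0"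
        by (simp add: inner_complex_def algebra_simps)
      with assms[OF i] t show ?thesis by auto
    qed
    thus ?thesis by (metis (no_types, lifting) finite.simps insertCI is_singletonI' is_singleton_def)
  qed
  hence "finite (\<Union>i<n. {t \<in> I. q + of_real t * d \<in> closed_segment (x i) (x (Suc i))})" by blast
  moreover have "{t \<in> I. q + of_real t * d \<in> polygon x n} = (\<Union>i<n. {t \<in> I. q + of_real t * d \<in> closed_segment (x i) (x (Suc i))})"
    by (auto simp: polygon_def)
  ultimately show ?thesis by simp
qed

text \<open>
  With \<open>\<sigma> = -1\<close>, the step from \<open>a\<close> to \<open>b\<close> leads to the right, so the one from \<open>b\<close> to \<open>a\<close> leads
  to the left. The sign lets maxima and minima of the winding number be treated together.
\<close>

lemma polygon_crossing_signed:
  assumes \<sigma>: "\<sigma> = 1 \<or> \<sigma> = (-1::real)"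
    and closed: "x n = x 0" and ab: "a \<notin> polygon x n" "b \<notin> polygon x n"
    and meets: "closed_segment a b \<inter> polygon x n \<noteq> {}"
    and pos: "\<And>i. i < n \<Longrightarrow> closed_segment a b \<inter> closed_segment (x i) (x (Suc i)) \<noteq> {} \<Longrightarrow>
               \<sigma> * ((\<i> * (x (Suc i) - x i)) \<bullet> (b - a)) > 0"
  shows "\<sigma> * Re (polygon_winding x n b) \<ge> \<sigma> * Re (polygon_winding x n a) + 1"
  using \<sigma>
proof
  assume "\<sigma> = 1"
  with polygon_crossing[OF closed ab meets] pos show ?thesis by simp
next
  assume s: "\<sigma> = -1"
  have "Re (polygon_winding x n a) \<ge> Re (polygon_winding x n b) + 1"
  proof (rule polygon_crossing[OF closed ab(2,1)])
    show "closed_segment b a \<inter> polygon x n \<noteq> {}" using meets by (simp add: closed_segment_commute)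
    fix i assume "i < n" "closed_segment b a \<inter> closed_segment (x i) (x (Suc i)) \<noteq> {}"
    with pos[of i] show "(\<i> * (x (Suc i) - x i)) \<bullet> (a - b) > 0"
      by (simp add: s closed_segment_commute inner_diff_right)
  qed
  thus ?thesis by (simp add: s)
qed

lemma uniform_positivity_near_edges:
  fixes g :: "complex \<Rightarrow> complex"
  assumes g: "continuous_on UNIV g"
    and pos: "\<And>i y. i < n \<Longrightarrow> y \<in> closed_segment (x i) (x (Suc i)) \<Longrightarrow> (x (Suc i) - x i) \<bullet> g y > 0"
  obtains r c where "r > 0" "c > 0"
    "\<And>i y q. i < n \<Longrightarrow> y \<in> closed_segment (x i) (x (Suc i)) \<Longrightarrow> dist y q \<le> r \<Longrightarrow> (x (Suc i) - x i) \<bullet> g q \<ge> c"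
proof -
  have "\<exists>r c. 0 < r \<and> 0 < c \<and> (\<forall>i<n. \<forall>y \<in> closed_segment (x i) (x (Suc i)). \<forall>q. dist y q \<le> r \<longrightarrow> (x (Suc i) - x i) \<bullet> g q \<ge> c)"
    using pos
  proof (induction n)
    case 0
    show ?case by (auto intro: exI[of _ 1])
  next
    case (Suc n)
    obtain r c where rc: "0 < r" "0 < c"
      "\<forall>i<n. \<forall>y \<in> closed_segment (x i) (x (Suc i)). \<forall>q. dist y q \<le> r \<longrightarrow> (x (Suc i) - x i) \<bullet> g q \<ge> c"
      using Suc.IH Suc.prems by (metis less_Suc_eq)
    let ?E = "closed_segment (x n) (x (Suc n))" and ?h = "\<lambda>y. (x (Suc n) - x n) \<bullet> g y"
    have ch: "continuous_on S ?h" for S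
      using g by (intro continuous_intros) (auto intro: continuous_on_subset)
    obtain m where m: "m \<in> ?E" "\<And>y. y \<in> ?E \<Longrightarrow> ?h m \<le> ?h y"
      using continuous_attains_inf[OF compact_segment _ ch] by (metis empty_iff ends_in_segment(1))
    have m0: "?h m > 0" using Suc.prems[of n] m(1) by simp
    have "open {y. ?h m / 2 < ?h y}" by (intro open_Collect_less continuous_on_const ch)
    moreover have "?E \<subseteq> {y. ?h m / 2 < ?h y}"
    proof
      fix y assume "y \<in> ?E"
      with m(2)[of y] m0 show "y \<in> {y. ?h m / 2 < ?h y}" by simp
    qed
    ultimately obtain e where e: "e > 0" "(\<Union>y\<in>?E. cball y e) \<subseteq> {y. ?h m / 2 < ?h y}"
      using compact_subset_open_imp_cball_epsilon_subset[OF compact_segment] by metis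
    show ?case
    proof (rule exI[of _ "min r e"], rule exI[of _ "min c (?h m / 2)"], intro conjI allI impI ballI)
      fix i y q assume i: "i < Suc n" and y: "y \<in> closed_segment (x i) (x (Suc i))" and d: "dist y q \<le> min r e"
      show "min c (?h m / 2) \<le> (x (Suc i) - x i) \<bullet> g q"
      proof (cases "i = n")
        case True
        hence "q \<in> (\<Union>y\<in>?E. cball y e)" using y d by auto
        hence "q \<in> {y. ?h m / 2 < ?h y}" by (rule subsetD[OF e(2)])
        hence "?h m / 2 \<le> ?h q" by simp
        thus ?thesis using True by (simp add: min.coboundedI2)
      next
        case False
        hence "c \<le> (x (Suc i) - x i) \<bullet> g q" using rc(3) i y d by auto
        thus ?thesis by linarith
      qed
    qed (use rc e m0 in auto)
  qed
  thus ?thesis using that by metis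
qed

text \<open>
  A short segment through the vertex \<open>x 0\<close> in the direction \<open>\<i> g (x 0)\<close> crosses every edge near
  \<open>x 0\<close> from right to left. In particular no cancellation occurs between edges that overlap.
\<close>

lemma nonzero_polygon_winding:
  fixes g :: "complex \<Rightarrow> complex"
  assumes g: "continuous_on UNIV g" and n: "n \<ge> 1" and closed: "x n = x 0"
    and pos: "\<And>i y. i < n \<Longrightarrow> y \<in> closed_segment (x i) (x (Suc i)) \<Longrightarrow> (x (Suc i) - x i) \<bullet> g y > 0"
  obtains q where "q \<notin> polygon x n" "Re (polygon_winding x n q) \<noteq> 0"
proof -
  obtain r c where rc: "r > 0" "c > 0"
    "\<And>i y q. i < n \<Longrightarrow> y \<in> closed_segment (x i) (x (Suc i)) \<Longrightarrow> dist y q \<le> r \<Longrightarrow> (x (Suc i) - x i) \<bullet> g q \<ge> c"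
    using uniform_positivity_near_edges[OF g, of n x] pos by metis
  define d where "d = \<i> * g (x 0)"
  have "g (x 0) \<noteq> 0" using pos[of 0 "x 0"] n by auto
  define T where "T = r / norm d"
  have T: "T > 0" using rc \<open>g (x 0) \<noteq> 0\<close> by (simp add: T_def d_def)
  have trans: "(\<i> * (x (Suc i) - x i)) \<bullet> d > 0"
    if "i < n" "\<bar>t\<bar> \<le> T" "x 0 + of_real t * d \<in> closed_segment (x i) (x (Suc i))" for i t
  proof -
    have "norm d > 0" using \<open>g (x 0) \<noteq> 0\<close> by (simp add: d_def)
    hence "\<bar>t\<bar> * norm d \<le> r" using that(2) by (simp add: T_def field_simps)
    hence "dist (x 0 + of_real t * d) (x 0) \<le> r" by (simp add: dist_norm norm_mult)
    from rc(3)[OF that(1,3) this] rc(2) show ?thesis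
      by (simp add: d_def inner_complex_def algebra_simps)
  qed
  have fin: "finite {t \<in> {-T..T}. x 0 + of_real t * d \<in> polygon x n}" (is "finite ?F")
  proof (rule finite_transversal_meets)
    fix i t assume "i < n" "t \<in> {-T..T}" "x 0 + of_real t * d \<in> closed_segment (x i) (x (Suc i))"
    with trans[of i t] show "(\<i> * (x (Suc i) - x i)) \<bullet> d \<noteq> 0" by (auto simp: abs_le_iff)
  qed
  hence "infinite ({0<..<T} - (?F \<union> uminus ` ?F))"
    using T by (intro Diff_infinite_finite) auto
  then obtain s where s: "s \<in> {0<..<T} - (?F \<union> uminus ` ?F)"
    by (metis (no_types, lifting) ex_in_conv finite.emptyI)
  define a b where "a = x 0 + of_real (-s) * d" and "b = x 0 + of_real s * d"
  have "a \<notin> polygon x n"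
  proof
    assume "a \<in> polygon x n"
    hence "-s \<in> ?F" using s by (auto simp: a_def)
    hence "s \<in> uminus ` ?F" by (metis (no_types, lifting) image_eqI minus_minus)
    thus False using s by blast
  qed
  moreover have "b \<notin> polygon x n" using s by (auto simp: b_def)
  moreover have seg: "\<exists>t. \<bar>t\<bar> \<le> s \<and> y = x 0 + of_real t * d" if y: "y \<in> closed_segment a b" for y
  proof -
    obtain u where u: "0 \<le> u" "u \<le> 1" "y = (1 - u) *\<^sub>R a + u *\<^sub>R b" using y by (auto simp: in_segment)
    have "y = x 0 + of_real ((2 * u - 1) * s) * d"
      unfolding u a_def b_def by (simp add: scaleR_conv_of_real algebra_simps)
    moreover have "\<bar>(2 * u - 1) * s\<bar> \<le> s"
      using u s by (auto simp: abs_mult intro!: mult_left_le_one_le)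
    ultimately show ?thesis by blast
  qed
  have "Re (polygon_winding x n b) \<ge> Re (polygon_winding x n a) + 1"
  proof (rule polygon_crossing[OF closed \<open>a \<notin> _\<close> \<open>b \<notin> _\<close>])
    have "x 0 = midpoint a b" by (simp add: midpoint_def a_def b_def scaleR_conv_of_real)
    hence "x 0 \<in> closed_segment a b" by (metis midpoint_in_closed_segment)
    thus "closed_segment a b \<inter> polygon x n \<noteq> {}" using vertex_in_polygon[of x n 0] closed n by auto
    fix i assume i: "i < n" and "closed_segment a b \<inter> closed_segment (x i) (x (Suc i)) \<noteq> {}"
    then obtain t where t: "\<bar>t\<bar> \<le> s" "x 0 + of_real t * d \<in> closed_segment (x i) (x (Suc i))"
      using seg by (metis disjoint_iff)
    have "(\<i> * (x (Suc i) - x i)) \<bullet> d > 0" using trans[OF i _ t(2)] t s by auto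
    moreover have "b - a = of_real (2 * s) * d" by (simp add: a_def b_def algebra_simps)
    hence "(\<i> * (x (Suc i) - x i)) \<bullet> (b - a) = 2 * s * ((\<i> * (x (Suc i) - x i)) \<bullet> d)"
      by (simp only: flip: scaleR_conv_of_real) simp
    ultimately show "(\<i> * (x (Suc i) - x i)) \<bullet> (b - a) > 0" using s by simp
  qed
  hence "Re (polygon_winding x n a) \<noteq> 0 \<or> Re (polygon_winding x n b) \<noteq> 0" by linarith
  with \<open>a \<notin> _\<close> \<open>b \<notin> _\<close> show ?thesis using that by blast
qed

lemma extremal_polygon_winding:
  assumes closed: "x n = x 0" and n: "n \<ge> 1"
    and q0: "q0 \<notin> polygon x n" "Re (polygon_winding x n q0) \<noteq> 0"
  obtains \<sigma> q1 where "\<sigma> = 1 \<or> \<sigma> = (-1::real)" "q1 \<notin> polygon x n" "Re (polygon_winding x n q1) \<noteq> 0"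
    "\<And>q. q \<notin> polygon x n \<Longrightarrow> \<sigma> * Re (polygon_winding x n q) \<le> \<sigma> * Re (polygon_winding x n q1)"
proof -
  define \<sigma> where "\<sigma> = sgn (Re (polygon_winding x n q0))"
  have \<sigma>: "\<sigma> = 1 \<or> \<sigma> = -1" using q0(2) by (auto simp: \<sigma>_def sgn_if)
  define f where "f = (\<lambda>q. nat \<lfloor>\<sigma> * Re (polygon_winding x n q)\<rfloor>)"
  have f: "real (f q) = max 0 (\<sigma> * Re (polygon_winding x n q))" if q: "q \<notin> polygon x n" for q
  proof -
    obtain k where "polygon_winding x n q = of_int k"
      using polygon_winding_Ints[OF closed q] by (auto elim: Ints_cases)
    hence "\<sigma> * Re (polygon_winding x n q) = of_int (if \<sigma> = 1 then k else - k)" using \<sigma> by auto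
    then obtain j :: int where "\<sigma> * Re (polygon_winding x n q) = of_int j" by blast
    thus ?thesis by (simp add: f_def max_def)
  qed
  have bdd: "f q < n" if q: "q \<notin> polygon x n" for q
    using abs_Re_polygon_winding[OF q n] f[OF q] \<sigma> n by (auto simp: max_def split: if_splits)
  have "\<exists>q1. q1 \<notin> polygon x n \<and> (\<forall>q. q \<notin> polygon x n \<longrightarrow> f q \<le> f q1)"
    using ex_has_greatest_nat[of "\<lambda>q. q \<notin> polygon x n", OF q0(1)] bdd by blast
  then obtain q1 where q1: "q1 \<notin> polygon x n" "\<And>q. q \<notin> polygon x n \<Longrightarrow> f q \<le> f q1" by metis
  have "\<sigma> * Re (polygon_winding x n q0) > 0" using q0(2) by (auto simp: \<sigma>_def sgn_if)
  hence "real (f q0) > 0" using f[OF q0(1)] by auto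
  hence pos: "real (f q1) > 0" using q1(2)[OF q0(1)] by linarith
  have f1: "\<sigma> * Re (polygon_winding x n q1) = real (f q1)" using f[OF q1(1)] pos by (simp add: max_def split: if_splits)
  show ?thesis
  proof (rule that[OF \<sigma> q1(1)])
    show "Re (polygon_winding x n q1) \<noteq> 0" using f1 pos by auto
    fix q assume q: "q \<notin> polygon x n"
    have "\<sigma> * Re (polygon_winding x n q) \<le> real (f q)" unfolding f[OF q] by simp
    also have "\<dots> \<le> real (f q1)" using q1(2)[OF q] by simp
    finally show "\<sigma> * Re (polygon_winding x n q) \<le> \<sigma> * Re (polygon_winding x n q1)" using f1 by simp
  qed
qed

text \<open>
  Pushing points along \<open>\<sigma> \<i> g\<close> keeps them in a component \<open>U\<close> where \<open>\<sigma>\<close> times the winding number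
  attains a positive maximum, because leaving \<open>U\<close> in this direction would increase it further.
\<close>

theorem zero_in_winding_region:
  fixes g :: "complex \<Rightarrow> complex"
  assumes g: "continuous_on UNIV g" and n: "n \<ge> 1" and closed: "x n = x 0"
    and pos: "\<And>i y. i < n \<Longrightarrow> y \<in> closed_segment (x i) (x (Suc i)) \<Longrightarrow> (x (Suc i) - x i) \<bullet> g y > 0"
  obtains z where "z \<notin> polygon x n" "g z = 0" "polygon_winding x n z \<noteq> 0"
proof -
  let ?K = "polygon x n" and ?W = "polygon_winding x n"
  obtain q0 where q0: "q0 \<notin> ?K" "Re (?W q0) \<noteq> 0"
    using nonzero_polygon_winding[of g n x, OF g n closed] pos by metis
  obtain \<sigma> q1 where \<sigma>: "\<sigma> = 1 \<or> \<sigma> = (-1::real)" and q1: "q1 \<notin> ?K" "Re (?W q1) \<noteq> 0"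
    and max: "\<And>q. q \<notin> ?K \<Longrightarrow> \<sigma> * Re (?W q) \<le> \<sigma> * Re (?W q1)"
    using extremal_polygon_winding[of x n q0, OF closed n q0] by metis
  obtain r c where rc: "r > 0" "c > 0"
    "\<And>i y q. i < n \<Longrightarrow> y \<in> closed_segment (x i) (x (Suc i)) \<Longrightarrow> dist y q \<le> r \<Longrightarrow> (x (Suc i) - x i) \<bullet> g q \<ge> c"
    using uniform_positivity_near_edges[OF g, of n x] pos by metis

  define U where "U = connected_component_set (- ?K) q1"
  have q1U: "q1 \<in> U" using q1 by (simp add: U_def)
  have UK: "U \<subseteq> - ?K" by (simp add: U_def connected_component_subset)
  have openU: "open U" unfolding U_def
    by (intro open_connected_component) (simp add: closed_def[symmetric] compact_imp_closed compact_polygon)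
  have connU: "connected U" by (simp add: U_def)
  have U_maximal: "S \<subseteq> U" if "connected S" "S \<inter> ?K = {}" "S \<inter> U \<noteq> {}" for S
  proof -
    from that(3) obtain q where q: "q \<in> S" "q \<in> U" by blast
    have "S \<subseteq> connected_component_set (- ?K) q"
      using that q by (intro connected_component_maximal) auto
    also have "\<dots> = U" using q(2) unfolding U_def by (metis connected_component_eq)
    finally show ?thesis .
  qed
  have WU: "?W q = ?W q1" if "q \<in> U" for q
    using polygon_winding_constant[of x n U q q1] closed connU UK q1U that by auto
  obtain R where R: "\<And>y. y \<in> ?K \<Longrightarrow> norm y < R"
    using compact_imp_bounded[OF compact_polygon[of x n]] by (auto simp: bounded_pos_less)
  have UR: "U \<subseteq> cball 0 R"
  proof
    fix q assume q: "q \<in> U"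
    have "\<not> norm q > R"
    proof
      assume "norm q > R"
      hence "?W q = 0" using R closed by (intro polygon_winding_eq_0_outside) fastforce+
      thus False using WU[OF q] q1(2) by simp
    qed
    thus "q \<in> cball 0 R" by simp
  qed
  have bddU: "bounded U" using UR bounded_cball bounded_subset by blast
  have scU: "simply_connected U"
  proof -
    have "U \<in> components (- ?K)" using q1 by (auto simp: U_def components_def)
    hence "connected (frontier U)"
      using connected_frontier_component_complement[OF connected_polygon] by blast
    thus ?thesis using simply_connected_eq_frontier_properties[OF openU] connU bddU by simp
  qed

  have "bounded (g ` cball 0 R)"
    using g by (intro compact_imp_bounded compact_continuous_image) (auto intro: continuous_on_subset)
  then obtain B where B: "B > 0" "\<And>q. q \<in> U \<Longrightarrow> norm (g q) \<le> B"
    using UR unfolding bounded_pos by (metis (no_types, lifting) image_eqI subsetD)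
  define V where "V = 1 + (\<Sum>i<n. norm (x (Suc i) - x i))"
  have V0: "V > 0" unfolding V_def by (intro add_pos_nonneg sum_nonneg) auto
  have V: "norm (x (Suc i) - x i) \<le> V" if "i < n" for i
    using member_le_sum[of i "{..<n}" "\<lambda>i. norm (x (Suc i) - x i)"] that by (simp add: V_def)
  \<comment> \<open>The step \<open>\<epsilon> \<sigma> \<i> g q\<close> has length at most \<open>r / 2\<close>. A further error of size \<open>\<eta>\<close> still leaves
      the direction transversal to all edges within distance \<open>r\<close>, on the side prescribed by \<open>\<sigma>\<close>.\<close>
  define \<epsilon> where "\<epsilon> = r / (2 * B)"
  define \<eta> where "\<eta> = min (r / 4) (\<epsilon> * c / (2 * V))"
  have \<epsilon>0: "\<epsilon> > 0" using rc B by (simp add: \<epsilon>_def)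
  have \<eta>0: "\<eta> > 0" using rc \<epsilon>0 V0 by (simp add: \<eta>_def)
  define \<phi> where "\<phi> = (\<lambda>q. q + of_real (\<epsilon> * \<sigma>) * (\<i> * g q))"

  \<comment> \<open>The uniform margin \<open>\<eta>\<close> is what puts the closure of \<open>\<phi> ` U\<close>, and not just \<open>\<phi> ` U\<close>, inside \<open>U\<close>.\<close>
  have stay: "\<phi> q + u \<in> U" if q: "q \<in> U" and u: "norm u \<le> \<eta>" for q u
  proof -
    define d where "d = of_real (\<epsilon> * \<sigma>) * (\<i> * g q) + u"
    have qd: "\<phi> q + u = q + d" by (simp add: \<phi>_def d_def)
    have "norm d \<le> \<epsilon> * norm (g q) + norm u"
      unfolding d_def using \<sigma> \<epsilon>0
      by (intro order_trans[OF norm_triangle_ineq] add_mono) (auto simp: norm_mult)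
    also have "\<dots> \<le> \<epsilon> * B + r / 4"
      using \<epsilon>0 B(2)[OF q] u by (intro add_mono mult_left_mono) (auto simp: \<eta>_def)
    also have "\<dots> = 3 / 4 * r" using B by (simp add: \<epsilon>_def)
    finally have d: "norm d \<le> 3 / 4 * r" .
    have trans: "\<sigma> * ((\<i> * (x (Suc i) - x i)) \<bullet> d) > 0"
      if i: "i < n" and t: "0 \<le> t" "t \<le> 4 / 3" and y: "q + of_real t * d \<in> closed_segment (x i) (x (Suc i))" for i t
    proof -
      let ?v = "x (Suc i) - x i"
      have "t * norm d \<le> 4 / 3 * (3 / 4 * r)" using t d by (intro mult_mono) auto
      hence "dist (q + of_real t * d) q \<le> r" using t by (simp add: dist_norm norm_mult)
      hence 1: "?v \<bullet> g q \<ge> c" using rc(3)[OF i y] by blast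
      have "\<sigma> * ((\<i> * ?v) \<bullet> d) = \<epsilon> * (?v \<bullet> g q) + \<sigma> * ((\<i> * ?v) \<bullet> u)"
        unfolding d_def using \<sigma> by (auto simp: inner_complex_def algebra_simps)
      moreover have "\<epsilon> * (?v \<bullet> g q) \<ge> \<epsilon> * c" using 1 \<epsilon>0 by simp
      moreover have "\<bar>\<sigma> * ((\<i> * ?v) \<bullet> u)\<bar> \<le> V * (\<epsilon> * c / (2 * V))"
      proof -
        have "\<bar>\<sigma> * ((\<i> * ?v) \<bullet> u)\<bar> = \<bar>(\<i> * ?v) \<bullet> u\<bar>" using \<sigma> by auto
        also have "\<dots> \<le> norm (\<i> * ?v) * norm u" by (rule Cauchy_Schwarz_ineq2)
        also have "\<dots> = norm ?v * norm u" by (simp add: norm_mult)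
        also have "\<dots> \<le> V * (\<epsilon> * c / (2 * V))"
          using V[OF i] V0 u by (intro mult_mono) (auto simp: \<eta>_def)
        finally show ?thesis .
      qed
      moreover have "V * (\<epsilon> * c / (2 * V)) = \<epsilon> * c / 2" using V0 by simp
      moreover have "\<epsilon> * c > 0" using \<epsilon>0 rc by simp
      ultimately show ?thesis by linarith
    qed
    \<comment> \<open>The point \<open>q + d\<close> might lie on the polygon; the step is prolonged slightly, up to a point \<open>b\<close>
        off the polygon, so that winding numbers at both ends can be compared.\<close>
    have "finite {t \<in> {0..4/3}. q + of_real t * d \<in> ?K}" (is "finite ?F")
    proof (rule finite_transversal_meets)
      fix i t assume "i < n" "t \<in> {0..4/3::real}" "q + of_real t * d \<in> closed_segment (x i) (x (Suc i))"
      with trans[of i t] show "(\<i> * (x (Suc i) - x i)) \<bullet> d \<noteq> 0" by auto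
    qed
    hence "infinite ({1<..<4/3::real} - ?F)" by (intro Diff_infinite_finite) auto
    then obtain T where T: "T \<in> {1<..<4/3} - ?F" by (metis ex_in_conv finite.emptyI)
    define b where "b = q + of_real T * d"
    have b: "b \<notin> ?K" using T by (auto simp: b_def)
    have seg: "\<exists>t. 0 \<le> t \<and> t \<le> T \<and> y = q + of_real t * d" if y: "y \<in> closed_segment q b" for y
    proof -
      obtain w where w: "0 \<le> w" "w \<le> 1" "y = (1 - w) *\<^sub>R q + w *\<^sub>R b" using y by (auto simp: in_segment)
      have "y = q + of_real (w * T) * d"
        unfolding w b_def by (simp add: scaleR_conv_of_real algebra_simps)
      moreover have "0 \<le> w * T" "w * T \<le> T" using w T by (auto intro!: mult_left_le_one_le)
      ultimately show ?thesis by blast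
    qed
    have "closed_segment q b \<inter> ?K = {}"
    proof (rule ccontr)
      assume meets: "closed_segment q b \<inter> ?K \<noteq> {}"
      have qK: "q \<notin> ?K" using q UK by blast
      have "\<sigma> * Re (?W b) \<ge> \<sigma> * Re (?W q) + 1"
      proof (rule polygon_crossing_signed[OF \<sigma> closed qK b meets])
        fix i assume i: "i < n" and "closed_segment q b \<inter> closed_segment (x i) (x (Suc i)) \<noteq> {}"
        then obtain t where t: "0 \<le> t" "t \<le> T" "q + of_real t * d \<in> closed_segment (x i) (x (Suc i))"
          using seg by (metis disjoint_iff)
        have "b - q = T *\<^sub>R d" by (simp add: b_def scaleR_conv_of_real)
        hence eq: "\<sigma> * ((\<i> * (x (Suc i) - x i)) \<bullet> (b - q)) = T * (\<sigma> * ((\<i> * (x (Suc i) - x i)) \<bullet> d))"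
          by simp
        have "\<sigma> * ((\<i> * (x (Suc i) - x i)) \<bullet> d) > 0" using trans[OF i t(1) _ t(3)] t T by simp
        thus "\<sigma> * ((\<i> * (x (Suc i) - x i)) \<bullet> (b - q)) > 0"
          unfolding eq using T by (simp only: zero_less_mult_iff) auto
      qed
      with max[OF b] WU[OF q] show False by simp
    qed
    hence "closed_segment q b \<subseteq> U" using q by (intro U_maximal) auto
    moreover have "q + d = (1 - 1 / T) *\<^sub>R q + (1 / T) *\<^sub>R b"
      using T by (simp add: b_def scaleR_conv_of_real algebra_simps)
    hence "q + d \<in> closed_segment q b" using T
      unfolding in_segment by (intro exI[of _ "1 / T"]) auto
    ultimately show ?thesis unfolding qd by blast
  qed

  have "closure (\<phi> ` U) \<subseteq> U"
  proof
    fix p assume "p \<in> closure (\<phi> ` U)"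
    then obtain q where q: "q \<in> U" "dist (\<phi> q) p < \<eta>"
      using \<eta>0 by (auto simp: closure_approachable)
    thus "p \<in> U" using stay[of q "p - \<phi> q"] by (simp add: dist_norm norm_minus_commute)
  qed
  moreover have "bounded (\<phi> ` U)"
    using stay[where u = 0] \<eta>0 by (intro bounded_subset[OF bddU]) auto
  hence "compact (closure (\<phi> ` U))" by simp
  moreover have "continuous_on U \<phi>" unfolding \<phi>_def
    using g by (intro continuous_intros) (auto intro: continuous_on_subset)
  ultimately obtain z where z: "z \<in> U" "\<phi> z = z"
    using fixed_point_simply_connected[OF openU scU] q1U closure_subset by (metis empty_iff)
  have "g z = 0" using z(2) \<epsilon>0 \<sigma> by (auto simp: \<phi>_def)
  moreover have "z \<notin> ?K" "?W z \<noteq> 0" using z(1) UK WU q1(2) by auto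
  ultimately show ?thesis using that by blast
qed

section \<open>Linking numbers as winding numbers of polygons\<close>

text \<open>
  The square \<open>(s, t) \<mapsto> (1 - t) c(s) + t f (c(s))\<close> avoids \<open>z\<close>, so the argument around \<open>z\<close> has a
  continuous branch on it and its variations along the four sides add up to zero. The sides
  are \<open>c\<close>, its image, and the segments that join the endpoints of \<open>c\<close> to their images.
\<close>

lemma winding_number_image_path:
  fixes f :: "complex \<Rightarrow> complex"
  assumes f: "continuous_on UNIV f"
    and avoid: "\<forall>y. y \<noteq> z \<longrightarrow> z \<notin> closed_segment y (f y)"
    and c: "path c" "z \<notin> path_image c"
  shows "winding_number (f \<circ> c) z = winding_number c z
     + winding_number (linepath (pathfinish c) (f (pathfinish c))) z
     - winding_number (linepath (pathstart c) (f (pathstart c))) z"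
proof -
  define H where "H = (\<lambda>(s, t). linepath (c s) (f (c s)) t - z)"
  let ?Q = "{0..1::real} \<times> {0..1::real}"
  have "continuous_on {0..1} c" using c(1) by (simp add: path_def)
  hence "continuous_on ?Q (\<lambda>p. c (fst p))"
    by (rule continuous_on_compose2) (auto intro: continuous_intros)
  moreover from this have "continuous_on ?Q (\<lambda>p. f (c (fst p)))"
    by (rule continuous_on_compose2[OF f]) auto
  ultimately have "continuous_on ?Q H"
    unfolding H_def linepath_def case_prod_unfold by (intro continuous_intros)
  moreover have "contractible ?Q" by (intro convex_imp_contractible convex_Times convex_real_interval)
  moreover have "H p \<noteq> 0" if "p \<in> ?Q" for p
  proof -
    have "c (fst p) \<noteq> z" using that c(2) by (force simp: path_image_def)
    moreover have "linepath (c (fst p)) (f (c (fst p))) (snd p) \<in> closed_segment (c (fst p)) (f (c (fst p)))"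
      using that by (intro linepath_in_path) auto
    ultimately show ?thesis using avoid by (auto simp: H_def case_prod_unfold)
  qed
  ultimately obtain L where L: "continuous_on ?Q L" "\<And>p. p \<in> ?Q \<Longrightarrow> H p = exp (L p)"
    using continuous_logarithm_on_contractible by metis
  have L': "linepath (c s) (f (c s)) t = z + exp (L (s, t))" if "s \<in> {0..1}" "t \<in> {0..1}" for s t
    using L(2)[of "(s, t)"] that by (simp add: H_def algebra_simps)
  have contL: "continuous_on {0..1} (\<lambda>u. L (p u))"
    if "continuous_on {0..1} p" "p ` {0..1} \<subseteq> ?Q" for p
    by (rule continuous_on_compose2[OF L(1) that])
  have "winding_number c z = (L (1, 0) - L (0, 0)) / (2 * of_real pi * \<i>)"
  proof (rule winding_number_eq_log_increment)
    show "continuous_on {0..1} (\<lambda>s. L (s, 0))" by (intro contL continuous_intros) auto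
    show "c s = z + exp (L (s, 0))" if "s \<in> {0..1}" for s
      using L'[OF that, of 0] by (simp add: linepath_def)
  qed
  moreover have "winding_number (f \<circ> c) z = (L (1, 1) - L (0, 1)) / (2 * of_real pi * \<i>)"
  proof (rule winding_number_eq_log_increment)
    show "continuous_on {0..1} (\<lambda>s. L (s, 1))" by (intro contL continuous_intros) auto
    show "(f \<circ> c) s = z + exp (L (s, 1))" if "s \<in> {0..1}" for s
      using L'[OF that, of 1] by (simp add: linepath_def)
  qed
  moreover have "winding_number (linepath (c s) (f (c s))) z = (L (s, 1) - L (s, 0)) / (2 * of_real pi * \<i>)"
    if "s \<in> {0..1}" for s
    using that L' by (intro winding_number_eq_log_increment contL continuous_intros) auto
  from this[of 0] this[of 1]
  have "winding_number (linepath (c 0) (f (c 0))) z = (L (0, 1) - L (0, 0)) / (2 * of_real pi * \<i>)"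
    "winding_number (linepath (c 1) (f (c 1))) z = (L (1, 1) - L (1, 0)) / (2 * of_real pi * \<i>)"
    by auto
  ultimately show ?thesis
    by (simp add: pathfinish_def pathstart_def diff_divide_distrib)
qed

text \<open>
  The corrections by \<open>winding_number_image_path\<close> telescope, because the final point of the
  \<open>i\<close>-th image of \<open>c\<close> is the initial point of the next one.
\<close>

lemma winding_number_iterate_path:
  fixes f :: "complex \<Rightarrow> complex"
  assumes f: "continuous_on UNIV f"
    and avoid: "\<forall>y. y \<noteq> z \<longrightarrow> z \<notin> closed_segment y (f y)"
    and c: "path c" "z \<notin> path_image c" "pathstart c = x" "pathfinish c = f x"
  shows "path ((f ^^ i) \<circ> c)" "z \<notin> path_image ((f ^^ i) \<circ> c)"
    "winding_number ((f ^^ i) \<circ> c) z = winding_number c z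
       + winding_number (linepath ((f ^^ i) x) ((f ^^ Suc i) x)) z - winding_number (linepath x (f x)) z"
proof -
  have "path ((f ^^ i) \<circ> c) \<and> z \<notin> path_image ((f ^^ i) \<circ> c) \<and>
    winding_number ((f ^^ i) \<circ> c) z = winding_number c z
       + winding_number (linepath ((f ^^ i) x) ((f ^^ Suc i) x)) z - winding_number (linepath x (f x)) z"
  proof (induction i)
    case 0
    show ?case using c by simp
  next
    case (Suc i)
    let ?c = "(f ^^ i) \<circ> c"
    have eq: "(f ^^ Suc i) \<circ> c = f \<circ> ?c" by (simp add: o_assoc)
    have ends: "pathstart ?c = (f ^^ i) x" "pathfinish ?c = (f ^^ Suc i) x"
      using c(3,4) by (simp_all add: pathstart_compose pathfinish_compose funpow_swap1)
    have IH: "path ?c" "z \<notin> path_image ?c" "winding_number ?c z = winding_number c z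
       + winding_number (linepath ((f ^^ i) x) ((f ^^ Suc i) x)) z - winding_number (linepath x (f x)) z"
      using Suc.IH by blast+
    have "path (f \<circ> ?c)"
      by (rule path_continuous_image[OF IH(1) continuous_on_subset[OF f]]) simp
    moreover have "f y \<noteq> z" if "y \<noteq> z" for y
      using avoid that by force
    hence "z \<notin> path_image (f \<circ> ?c)"
      using IH(2) by (metis (no_types, lifting) imageE path_image_compose)
    moreover have "winding_number (f \<circ> ?c) z = winding_number ?c z
       + winding_number (linepath ((f ^^ Suc i) x) (f ((f ^^ Suc i) x))) z
       - winding_number (linepath ((f ^^ i) x) (f ((f ^^ i) x))) z"
      using winding_number_image_path[OF f avoid IH(1,2)] unfolding ends .
    ultimately show ?case unfolding eq IH(3) by (simp add: o_def)
  qed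
  thus "path ((f ^^ i) \<circ> c)" "z \<notin> path_image ((f ^^ i) \<circ> c)"
    "winding_number ((f ^^ i) \<circ> c) z = winding_number c z
       + winding_number (linepath ((f ^^ i) x) ((f ^^ Suc i) x)) z - winding_number (linepath x (f x)) z"
    by auto
qed

lemma winding_number_iterate_join:
  fixes f :: "complex \<Rightarrow> complex"
  assumes f: "continuous_on UNIV f"
    and avoid: "\<forall>y. y \<noteq> z \<longrightarrow> z \<notin> closed_segment y (f y)"
    and c: "path c" "z \<notin> path_image c" "pathstart c = x" "pathfinish c = f x"
  shows "winding_number (iterate_join f c m) z = (\<Sum>i<Suc m. winding_number ((f ^^ i) \<circ> c) z)"
proof -
  note it = winding_number_iterate_path[OF f avoid c]
  have "path (iterate_join f c m) \<and> z \<notin> path_image (iterate_join f c m) \<and>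
    pathfinish (iterate_join f c m) = (f ^^ Suc m) x \<and>
    winding_number (iterate_join f c m) z = (\<Sum>i<Suc m. winding_number ((f ^^ i) \<circ> c) z)"
  proof (induction m)
    case 0
    show ?case using c by simp
  next
    case (Suc m)
    let ?d = "(f ^^ Suc m) \<circ> c"
    have ends: "pathstart ?d = (f ^^ Suc m) x" "pathfinish ?d = (f ^^ Suc (Suc m)) x"
      using c(3,4) by (simp_all add: pathstart_compose pathfinish_compose funpow_swap1)
    have d: "path ?d" "z \<notin> path_image ?d" by (rule it(1)) (rule it(2))
    show ?case
      using Suc.IH ends d by (auto simp: not_in_path_image_join winding_number_join o_def simp del: funpow.simps)
  qed
  thus ?thesis by blast
qed

text \<open>
  Here \<open>m\<close> counts how often \<open>c\<close> winds around \<open>z\<close> relative to the segment from \<open>x\<close> to \<open>f x\<close>.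
  Every iterate of \<open>c\<close> winds by the same amount relative to the corresponding edge of the polygon.
\<close>

lemma winding_number_iterate_join_mod:
  fixes f :: "complex \<Rightarrow> complex"
  assumes f: "continuous_on UNIV f"
    and avoid: "\<forall>y. y \<noteq> z \<longrightarrow> z \<notin> closed_segment y (f y)"
    and c: "path c" "z \<notin> path_image c" "pathstart c = x" "pathfinish c = f x"
    and n: "n \<ge> 1"
  obtains m :: int where
    "winding_number (iterate_join f c (n - 1)) z = of_nat n * of_int m + polygon_winding (\<lambda>i. (f ^^ i) x) n z"
proof -
  let ?\<tau> = "winding_number (linepath x (f x)) z"
  have "x \<noteq> z" using c(2,3) pathstart_in_path_image by metis
  hence lz: "z \<notin> path_image (linepath x (f x))"
    using avoid by simp
  have "winding_number (c +++ reversepath (linepath x (f x))) z \<in> \<int>"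
    using c lz by (intro integer_winding_number) (auto simp: not_in_path_image_join simp del: reversepath_linepath)
  moreover have "winding_number (c +++ reversepath (linepath x (f x))) z = winding_number c z - ?\<tau>"
    using c lz by (simp add: winding_number_join winding_number_reversepath del: reversepath_linepath)
  ultimately obtain m where m: "winding_number c z - ?\<tau> = of_int m" by (auto elim: Ints_cases)
  have "winding_number (iterate_join f c (n - 1)) z = (\<Sum>i<n. winding_number ((f ^^ i) \<circ> c) z)"
    using winding_number_iterate_join[OF f avoid c, of "n - 1"] n by simp
  also have "\<dots> = (\<Sum>i<n. of_int m + winding_number (linepath ((f ^^ i) x) ((f ^^ Suc i) x)) z)"
    using winding_number_iterate_path(3)[OF f avoid c] by (intro sum.cong refl) (simp flip: m)
  also have "\<dots> = of_nat n * of_int m + polygon_winding (\<lambda>i. (f ^^ i) x) n z"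
    by (simp add: sum.distrib polygon_winding_def)
  finally show ?thesis by (rule that)
qed

lemma polygon_winding_orbit_shift:
  assumes "(f ^^ n) x = x"
  shows "polygon_winding (\<lambda>i. (f ^^ i) ((f ^^ j) x)) n z = polygon_winding (\<lambda>i. (f ^^ i) x) n z"
proof (induction j)
  case (Suc j)
  define \<tau> where "\<tau> = (\<lambda>i. winding_number (linepath ((f ^^ (i + j)) x) ((f ^^ Suc (i + j)) x)) z)"
  have per: "(f ^^ (n + j)) x = (f ^^ j) x"
    using assms by (metis add.commute comp_apply funpow_add)
  have "polygon_winding (\<lambda>i. (f ^^ i) ((f ^^ Suc j) x)) n z - polygon_winding (\<lambda>i. (f ^^ i) ((f ^^ j) x)) n z
     = (\<Sum>i<n. \<tau> (Suc i) - \<tau> i)"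
    unfolding polygon_winding_def sum_subtractf[symmetric]
    by (intro sum.cong refl) (simp add: \<tau>_def funpow_add funpow_swap1)
  also have "\<dots> = \<tau> n - \<tau> 0" by (rule sum_lessThan_telescope)
  also have "\<dots> = 0" using per by (simp add: \<tau>_def)
  finally show ?case using Suc.IH by simp
qed simp

lemma card_periodic_orbit:
  assumes "periodic_point f n x"
  shows "card ((\<lambda>i. (f ^^ i) x) ` {0..n - 1}) = n"
proof -
  have n: "n \<ge> 1" "(f ^^ n) x = x" and min: "\<And>k. k \<in> {1..n - 1} \<Longrightarrow> (f ^^ k) x \<noteq> x"
    using assms by (auto simp: periodic_point_def)
  have no: False if "(f ^^ i) x = (f ^^ j) x" "i < j" "j \<le> n - 1" for i j
  proof -
    have "(f ^^ (n - j + i)) x = (f ^^ (n - j + j)) x"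
      unfolding funpow_add o_apply using that(1) by simp
    also have "\<dots> = x" using that n by simp
    finally have "(f ^^ (n - j + i)) x = x" .
    moreover have "1 \<le> n - j + i" "n - j + i \<le> n - 1" using that n(1) by linarith+
    ultimately show False using min by auto
  qed
  have "inj_on (\<lambda>i. (f ^^ i) x) {0..n - 1}"
  proof (rule inj_onI)
    fix i j assume "i \<in> {0..n - 1}" "j \<in> {0..n - 1}" "(f ^^ i) x = (f ^^ j) x"
    thus "i = j" using no[of i j] no[of j i] by (cases i j rule: linorder_cases) auto
  qed
  thus ?thesis using n by (simp add: card_image)
qed

text \<open>
  By \<open>winding_number_iterate_join_mod\<close> every admissible path yields the same residue, and the
  segment from \<open>x\<close> to \<open>f x\<close> is an admissible path, so exactly one integer has the defining
  property of the linking number.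
\<close>

lemma linking_number_eq_polygon_winding:
  fixes f :: "complex \<Rightarrow> complex"
  assumes f: "continuous_on UNIV f"
    and avoid: "\<forall>y. y \<noteq> z \<longrightarrow> z \<notin> closed_segment y (f y)"
    and x: "periodic_point f n x" "x \<noteq> z"
    and w: "polygon_winding (\<lambda>i. (f ^^ i) x) n z = of_int w"
  shows "linking_number f z ((\<lambda>i. (f ^^ i) x) ` {0..n - 1}) = w mod int n"
proof -
  have n: "n \<ge> 1" "(f ^^ n) x = x" using x by (auto simp: periodic_point_def)
  let ?O = "(\<lambda>i. (f ^^ i) x) ` {0..n - 1}"
  have wn: "\<exists>m::int. winding_number (iterate_join f c (n - 1)) z = of_int (int n * m + w)"
    if c: "y \<in> ?O" "path c" "pathstart c = y" "pathfinish c = f y" "z \<notin> path_image c" for y c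
  proof -
    from that(1) obtain j where j: "y = (f ^^ j) x" by blast
    obtain m :: int where "winding_number (iterate_join f c (n - 1)) z
       = of_nat n * of_int m + polygon_winding (\<lambda>i. (f ^^ i) y) n z"
      using winding_number_iterate_join_mod[OF f avoid c(2,5,3,4) n(1)] by metis
    thus ?thesis unfolding j polygon_winding_orbit_shift[OF n(2)] w by auto
  qed
  show ?thesis
    unfolding linking_number_def card_periodic_orbit[OF x(1)]
  proof (rule the_equality)
    have "\<exists>m::int. winding_number (iterate_join f c (n - 1)) z - of_int (w mod int n) = of_int (int n * m)"
      if c: "y \<in> ?O" "path c" "pathstart c = y" "pathfinish c = f y" "z \<notin> path_image c" for y c
    proof -
      obtain m where "winding_number (iterate_join f c (n - 1)) z = of_int (int n * m + w)"
        using wn[OF c] by blast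
      moreover have "int n * m + w - w mod int n = int n * (m + w div int n)"
        by (simp add: minus_mod_eq_mult_div distrib_left add_diff_eq[symmetric])
      ultimately show ?thesis by (metis of_int_diff)
    qed
    thus "w mod int n \<in> {0..int n - 1} \<and> (\<forall>y\<in>?O. \<forall>c. path c \<and> pathstart c = y \<and> pathfinish c = f y
        \<and> z \<notin> path_image c \<longrightarrow> (\<exists>m::int. winding_number (iterate_join f c (n - 1)) z - of_int (w mod int n)
           = of_int (int n * m)))"
      using n by auto
  next
    fix l assume l: "l \<in> {0..int n - 1} \<and> (\<forall>y\<in>?O. \<forall>c. path c \<and> pathstart c = y \<and> pathfinish c = f y
        \<and> z \<notin> path_image c \<longrightarrow> (\<exists>m::int. winding_number (iterate_join f c (n - 1)) z - of_int l
           = of_int (int n * m)))"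
    let ?c = "linepath x (f x)"
    have xO: "x \<in> ?O" by (rule image_eqI[of _ _ 0]) auto
    have c: "path ?c" "pathstart ?c = x" "pathfinish ?c = f x" "z \<notin> path_image ?c"
      using avoid x(2) by auto
    obtain m m' where "winding_number (iterate_join f ?c (n - 1)) z - of_int l = of_int (int n * m)"
      "winding_number (iterate_join f ?c (n - 1)) z = of_int (int n * m' + w)"
      using l wn[OF xO c] c xO by blast
    hence "of_int (int n * m' + w - l) = (of_int (int n * m) :: complex)" by simp
    hence "int n * m' + w - l = int n * m" by (simp only: of_int_eq_iff)
    hence "l = w + int n * (m' - m)" by (simp add: algebra_simps)
    hence "l mod int n = w mod int n" by simp
    moreover have "l mod int n = l" using l by simp
    ultimately show "l = w mod int n" by simp
  qed
qed

section \<open>The displacement field\<close>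

text \<open>
  If \<open>z = y + t g y\<close> is fixed, where \<open>g = f - Id\<close>, then \<open>|g y| = |g z - g y| \<le> t |g y|\<close>
  forces \<open>t = 1\<close>, so \<open>f y = z = f z\<close>; injectivity excludes this.
\<close>

lemma displacement_segment_avoids_fixed_point:
  fixes f :: "'a::real_normed_vector \<Rightarrow> 'a"
  assumes lip: "\<And>u v. norm ((f u - u) - (f v - v)) \<le> norm (u - v)"
    and inj: "inj f" and z: "f z = z" "y \<noteq> z"
  shows "z \<notin> closed_segment y (f y)"
proof
  assume "z \<in> closed_segment y (f y)"
  then obtain t where t: "t \<in> {0..1}" and z_eq: "z - y = t *\<^sub>R (f y - y)"
    by (auto simp: in_segment algebra_simps)
  have "norm (f y - y) \<le> t * norm (f y - y)"
    using lip[of z y] t unfolding z_eq by (simp add: z(1) norm_minus_commute)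
  moreover have "f y \<noteq> y" using z_eq z(2) by auto
  ultimately have "t = 1" using t by auto
  hence "f y = f z" using z_eq z(1) by simp
  thus False using inj z(2) by (auto dest: injD)
qed

text \<open>
  The vector \<open>w = g p\<close> lies in the closed ball of radius \<open>|g y|\<close> around \<open>g y\<close>, and every
  \<open>w \<noteq> 0\<close> in this ball satisfies \<open>2 (g y \<bullet> w) \<ge> |w|\<^sup>2\<close>.
\<close>

lemma displacement_on_segment:
  fixes f :: "'a::real_inner \<Rightarrow> 'a"
  assumes lip: "\<And>u v. norm ((f u - u) - (f v - v)) \<le> norm (u - v)"
    and inj: "inj f" and y: "f y \<noteq> y" and p: "p \<in> closed_segment y (f y)"
  shows "(f y - y) \<bullet> (f p - p) > 0"
proof -
  obtain t where t: "t \<in> {0..1}" "p - y = t *\<^sub>R (f y - y)"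
    using p by (auto simp: in_segment algebra_simps)
  have fp: "f p \<noteq> p"
    using displacement_segment_avoids_fixed_point[OF lip inj, of p y] p y by metis
  have "norm ((f p - p) - (f y - y)) \<le> norm (p - y)" by (rule lip)
  also have "norm (p - y) = norm (t *\<^sub>R (f y - y))" by (simp only: t(2))
  also have "\<dots> \<le> norm (f y - y)" using t(1) by (simp add: mult_left_le_one_le)
  finally have "(norm ((f p - p) - (f y - y)))\<^sup>2 \<le> (norm (f y - y))\<^sup>2"
    by (intro power_mono) auto
  hence "(norm (f p - p))\<^sup>2 \<le> 2 * ((f y - y) \<bullet> (f p - p))"
    unfolding power2_norm_eq_inner by (simp add: inner_diff_left inner_diff_right inner_commute)
  moreover have "(norm (f p - p))\<^sup>2 > 0" using fp by simp
  ultimately show ?thesis by linarith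
qed

theorem mainTheorem1:
  fixes f :: "complex \<Rightarrow> complex" and k :: real and n :: nat and \<O> :: "complex set"
  assumes "orientation_preserving_homeo f"
    and "k \<in> {0..1}"
    and "k-lipschitz_on UNIV (\<lambda>u. f u - u)"
    and "n \<ge> 2"
    and "periodic_orbit f n \<O>"
  shows "\<exists>x\<^sub>0. f x\<^sub>0 = x\<^sub>0 \<and> linking_number f x\<^sub>0 \<O> \<noteq> 0"
proof -
  obtain f' where "homeomorphism UNIV UNIV f f'"
    using assms(1) by (auto simp: orientation_preserving_homeo_def)
  hence contf: "continuous_on UNIV f" and inj: "inj f"
    by (auto simp: homeomorphism_def intro: inj_on_inverseI)
  have lip: "norm ((f u - u) - (f v - v)) \<le> norm (u - v)" for u v
  proof -
    have "norm ((f u - u) - (f v - v)) \<le> k * norm (u - v)"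
      using lipschitz_onD[OF assms(3), of u v] by (simp add: dist_norm)
    also have "\<dots> \<le> norm (u - v)" using assms(2) by (simp add: mult_left_le_one_le)
    finally show ?thesis .
  qed
  obtain x where x: "periodic_point f n x" and \<O>: "\<O> = (\<lambda>i. (f ^^ i) x) ` {0..n - 1}"
    using assms(5) by (auto simp: periodic_orbit_def)
  define X where "X = (\<lambda>i. (f ^^ i) x)"
  have n: "n \<ge> 1" using assms(4) by simp
  have closed: "X n = X 0" using x by (simp add: X_def periodic_point_def)
  have X_Suc: "X (Suc i) = f (X i)" for i by (simp add: X_def)
  have "1 \<in> {1..n - 1}" using assms(4) by auto
  hence "(f ^^ 1) x \<noteq> x" using x unfolding periodic_point_def by blast
  hence fx: "f x \<noteq> x" by simp
  have not_fixed: "f (X i) \<noteq> X i" for i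
  proof (induction i)
    case (Suc i)
    thus ?case unfolding X_Suc using inj by (auto dest: injD)
  qed (use fx in \<open>simp add: X_def\<close>)
  have pos: "(X (Suc i) - X i) \<bullet> (f p - p) > 0" if "p \<in> closed_segment (X i) (X (Suc i))" for i p
    using displacement_on_segment[OF lip inj not_fixed] that by (simp add: X_Suc)
  have "continuous_on UNIV (\<lambda>u. f u - u)" by (intro continuous_intros contf)
  from zero_in_winding_region[OF this n closed pos]
  obtain z where z: "z \<notin> polygon X n" "f z - z = 0" "polygon_winding X n z \<noteq> 0" by blast
  have fz: "f z = z" using z(2) by simp
  obtain w where w: "polygon_winding X n z = of_int w"
    using polygon_winding_Ints[of X n z, OF closed z(1)] by (auto elim: Ints_cases)
  have "x \<noteq> z" using fx fz by auto
  have "linking_number f z \<O> = w mod int n"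
    unfolding \<O>
    by (rule linking_number_eq_polygon_winding[OF contf _ x \<open>x \<noteq> z\<close>])
      (use displacement_segment_avoids_fixed_point[OF lip inj fz] w in \<open>auto simp: X_def\<close>)
  moreover have "w mod int n \<noteq> 0"
  proof
    assume "w mod int n = 0"
    hence "int n dvd w" by auto
    moreover have "w \<noteq> 0" using z(3) w by auto
    ultimately have "int n \<le> \<bar>w\<bar>" using dvd_imp_le_int[of w "int n"] by simp
    moreover have "\<bar>real_of_int w\<bar> < n / 2"
      using abs_Re_polygon_winding[OF z(1) n] w by simp
    ultimately show False by linarith
  qed
  ultimately show ?thesis using fz by auto
qed

end
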